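(* Suppose $s$ and $l$ are nonnegative integers and $b$ is a positive integer. Then $\tau_s(s+2,b) \geq l$ whenever $b \geq \binom{l+s+1}{l}(l+s+1)^{s+1}$.
   Context: All graphs are finite and simple. For graphs $G,H$ on disjoint vertex sets, the join $G \vee H$ is the graph consisting of $G$, $H$, and all edges joining a vertex of $G$ to a vertex of $H$; $K_n$ is the complete graph on $n$ vertices, and $K_0 \vee G$ is understood as $G$. $K_{a,b}$ is the complete bipartite graph with partite sets of sizes $a$ and $b$. $\chi$ denotes chromatic number and $\chi_\ell$ list chromatic number. For a nonnegative integer $s$ and positive integers $a,b$, $\tau_s(a,b)$ denotes the smallest nonnegative integer $n$ such that $\chi_\ell(K_n \vee K_{a,b}) - \chi(K_n \vee K_{a,b}) \leq s$. *)

theory Defs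
  imports Main
begin

type_synonym 'a graph = "'a set \<times> 'a set set"

abbreviation verts :: "'a graph \<Rightarrow> 'a set" where
  "verts G \<equiv> fst G"

abbreviation edges :: "'a graph \<Rightarrow> 'a set set" where
  "edges G \<equiv> snd G"

definition simple_graph :: "'a graph \<Rightarrow> bool" where
  "simple_graph G \<longleftrightarrow> finite (verts G) \<and> (\<forall>e\<in>edges G. e \<subseteq> verts G \<and> card e = 2)"

definition complete_graph :: "nat \<Rightarrow> nat graph" where
  "complete_graph n = ({..<n}, {{u, v} | u v. u < n \<and> v < n \<and> u \<noteq> v})"

definition complete_bipartite :: "nat \<Rightarrow> nat \<Rightarrow> (nat + nat) graph" where
  "complete_bipartite a b = ({..<a} <+> {..<b}, {{Inl i, Inr j} | i j. i < a \<and> j < b})"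

(* The sum type makes the two vertex sets disjoint. *)
definition join :: "'a graph \<Rightarrow> 'b graph \<Rightarrow> ('a + 'b) graph" where
  "join G H =
    (verts G <+> verts H,
     (`) Inl ` edges G \<union> (`) Inr ` edges H
       \<union> {{Inl u, Inr v} | u v. u \<in> verts G \<and> v \<in> verts H})"

definition proper_colouring :: "'a graph \<Rightarrow> ('a \<Rightarrow> nat) \<Rightarrow> bool" where
  "proper_colouring G c \<longleftrightarrow> (\<forall>u v. {u, v} \<in> edges G \<longrightarrow> c u \<noteq> c v)"

definition colourable :: "'a graph \<Rightarrow> nat \<Rightarrow> bool" where
  "colourable G k \<longleftrightarrow> (\<exists>c. proper_colouring G c \<and> c ` verts G \<subseteq> {..<k})"

definition chromatic_number :: "'a graph \<Rightarrow> nat" where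
  "chromatic_number G = (LEAST k. colourable G k)"

(* Natural numbers as colours are no restriction: the lists of a finite graph
   may be taken finite, so only finitely many colours occur. *)
definition choosable :: "'a graph \<Rightarrow> nat \<Rightarrow> bool" where
  "choosable G k \<longleftrightarrow>
    (\<forall>L :: 'a \<Rightarrow> nat set.
      (\<forall>v\<in>verts G. finite (L v) \<and> k \<le> card (L v)) \<longrightarrow>
      (\<exists>c. proper_colouring G c \<and> (\<forall>v\<in>verts G. c v \<in> L v)))"

definition list_chromatic_number :: "'a graph \<Rightarrow> nat" where
  "list_chromatic_number G = (LEAST k. choosable G k)"

(* The difference is taken in the integers to avoid truncated subtraction. *)
definition tau :: "nat \<Rightarrow> nat \<Rightarrow> nat \<Rightarrow> nat" where
  "tau s a b =
    (LEAST n.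
      int (list_chromatic_number (join (complete_graph n) (complete_bipartite a b)))
        - int (chromatic_number (join (complete_graph n) (complete_bipartite a b)))
      \<le> int s)"

lemma simple_graph_complete_graph: "simple_graph (complete_graph n)"
  by (auto simp: simple_graph_def complete_graph_def)

lemma simple_graph_complete_bipartite: "simple_graph (complete_bipartite a b)"
  by (auto simp: simple_graph_def complete_bipartite_def)

lemma simple_graph_join:
  assumes "simple_graph G" "simple_graph H"
  shows "simple_graph (join G H)"
  using assms by (fastforce simp: simple_graph_def join_def card_image)

end

theory Submission
  imports Defs "HOL-Library.FuncSet"
begin

text \<open>
  Write \<open>k = n + s + 2\<close>. The chromatic number of \<open>K\<^sub>n \<or> K\<^bsub>s+2,b\<^esub>\<close> is \<open>n + 2\<close>, so the condition
  defining \<open>\<tau>\<^sub>s\<close> says that this graph is \<open>k\<close>-choosable.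
  To defeat \<open>k\<close>-choosability, give the \<open>s + 2\<close> vertices of the small side pairwise disjoint lists
  \<open>A\<^sub>0, \<dots>, A\<^bsub>s+1\<^esub>\<close> of size \<open>k\<close> and all vertices of \<open>K\<^sub>n\<close> the list \<open>A\<^sub>0\<close>. Any colouring then uses
  \<open>n + 1\<close> colours of \<open>A\<^sub>0\<close> and one colour of each other \<open>A\<^sub>i\<close>; each of the
  \<open>(k choose (n + 1)) * k ^ (s + 1)\<close> colour sets of this kind has size \<open>k\<close> and can serve as the list
  of a vertex on the large side. With \<open>n + 1 \<le> l\<close> there are at most \<open>b\<close> of them.
  Since a least element of an empty set of naturals is unspecified, one must also show that the
  graph is \<open>k\<close>-choosable for some \<open>n\<close>. For \<open>n \<ge> 2 * b\<close>: if two vertices of the small side share a colour,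
  using it on both leaves a free colour for each vertex of the large side. Otherwise one of them has
  more than \<open>b\<close> colours left after colouring \<open>K\<^sub>n\<close>; colour it after reserving a colour for
  each of the \<open>b\<close> vertices of the large side.
\<close>

abbreviation clique_join_bipartite :: "nat \<Rightarrow> nat \<Rightarrow> nat \<Rightarrow> (nat + nat + nat) graph" where
  "clique_join_bipartite n a b \<equiv> join (complete_graph n) (complete_bipartite a b)"

section \<open>Greedy choice and list colouring of arbitrary simple graphs\<close>

lemma injective_choice:
  assumes "finite V" "\<And>v. v \<in> V \<Longrightarrow> card V \<le> card (L v)"
  shows "\<exists>c. inj_on c V \<and> (\<forall>v\<in>V. c v \<in> L v)"
  using assms
proof (induction V rule: finite_induct)
  case empty
  then show ?case by simp
next
  case (insert v V)
  have "card V \<le> card (L u)" if "u \<in> V" for u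
    using insert.prems[of u] insert.hyps that by simp
  then obtain c where c: "inj_on c V" "\<forall>u\<in>V. c u \<in> L u"
    using insert.IH by blast
  \<comment> \<open>Greedy step: the colours already used are too few to exhaust the list of
    \<open>v\<close>.\<close>
  have "card (c ` V) < card (L v)"
    using insert.prems[of v] insert.hyps card_image_le[of V c] by simp
  then have "\<not> L v \<subseteq> c ` V"
    using insert.hyps(1) card_mono[of "c ` V" "L v"] by auto
  then obtain x where "x \<in> L v" "x \<notin> c ` V"
    by blast
  then have "inj_on (c(v := x)) (insert v V) \<and> (\<forall>u\<in>insert v V. (c(v := x)) u \<in> L u)"
    using c insert.hyps(2) by (auto simp: inj_on_def)
  then show ?case by blast
qed

text \<open>Lists this long allow all vertices to get different colours. This shows that the
  \<open>LEAST\<close> in \<open>list_chromatic_number\<close> ranges over a nonempty set.\<close>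

lemma choosable_card_verts:
  assumes "simple_graph G"
  shows "choosable G (card (verts G))"
  unfolding choosable_def
proof (intro allI impI)
  fix L :: "'a \<Rightarrow> nat set"
  assume "\<forall>v\<in>verts G. finite (L v) \<and> card (verts G) \<le> card (L v)"
  then obtain c where c: "inj_on c (verts G)" "\<forall>v\<in>verts G. c v \<in> L v"
    using injective_choice[of "verts G" L] assms by (auto simp: simple_graph_def)
  have "c u \<noteq> c v" if "{u, v} \<in> edges G" for u v
  proof -
    have "{u, v} \<subseteq> verts G" "card {u, v} = 2"
      using assms that by (auto simp: simple_graph_def)
    moreover from this have "u \<noteq> v" by auto
    ultimately show ?thesis
      using c(1) by (auto simp: inj_on_def)
  qed
  with c show "\<exists>c. proper_colouring G c \<and> (\<forall>v\<in>verts G. c v \<in> L v)"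
    by (auto simp: proper_colouring_def)
qed

lemma choosable_mono: "choosable G k \<Longrightarrow> k \<le> m \<Longrightarrow> choosable G m"
  unfolding choosable_def by (fastforce dest: le_trans)

lemma list_chromatic_number_le_iff:
  assumes "simple_graph G"
  shows "list_chromatic_number G \<le> m \<longleftrightarrow> choosable G m"
  unfolding list_chromatic_number_def
  by (meson LeastI Least_le choosable_card_verts[OF assms] choosable_mono)

section \<open>Proper colourings and the chromatic number of the join\<close>

lemma proper_colouring_clique_join_bipartite:
  "proper_colouring (clique_join_bipartite n a b) c \<longleftrightarrow>
    inj_on (\<lambda>i. c (Inl i)) {..<n} \<and>
    (\<forall>i<n. \<forall>j<a. c (Inl i) \<noteq> c (Inr (Inl j))) \<and>
    (\<forall>i<n. \<forall>j<b. c (Inl i) \<noteq> c (Inr (Inr j))) \<and>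
    (\<forall>i<a. \<forall>j<b. c (Inr (Inl i)) \<noteq> c (Inr (Inr j)))"
  (is "?P \<longleftrightarrow> ?Q")
proof
  assume P: ?P
  let ?E = "edges (clique_join_bipartite n a b)"
  have "{Inl i, Inl j} \<in> ?E" if "i < n" "j < n" "i \<noteq> j" for i j
  proof -
    have "Inl ` {i, j} \<in> (`) (Inl :: nat \<Rightarrow> nat + nat + nat) ` edges (complete_graph n)"
      using that by (intro imageI) (auto simp: complete_graph_def)
    then have "Inl ` {i, j} \<in> ?E" by (simp add: join_def)
    then show ?thesis by simp
  qed
  moreover have "{Inr (Inl i), Inr (Inr j)} \<in> ?E" if "i < a" "j < b" for i j
  proof -
    have "Inr ` {Inl i, Inr j} \<in> (`) (Inr :: nat + nat \<Rightarrow> nat + nat + nat) ` edges (complete_bipartite a b)"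
      using that by (intro imageI) (auto simp: complete_bipartite_def)
    then have "Inr ` {Inl i, Inr j} \<in> ?E" by (simp add: join_def)
    then show ?thesis by simp
  qed
  moreover have "{Inl i, Inr (Inl j)} \<in> ?E" if "i < n" "j < a" for i j
    using that by (auto simp: join_def complete_graph_def complete_bipartite_def)
  moreover have "{Inl i, Inr (Inr j)} \<in> ?E" if "i < n" "j < b" for i j
    using that by (auto simp: join_def complete_graph_def complete_bipartite_def)
  ultimately show ?Q
    using P unfolding proper_colouring_def inj_on_def
    by (intro conjI ballI allI impI) (metis lessThan_iff, blast+)
next
  assume ?Q
  then show ?P
    unfolding proper_colouring_def join_def complete_graph_def complete_bipartite_def inj_on_def
    by (fastforce simp: doubleton_eq_iff image_iff)
qed

lemma verts_clique_join_bipartite: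
  "verts (clique_join_bipartite n a b) = {..<n} <+> ({..<a} <+> {..<b})"
  by (simp add: join_def complete_graph_def complete_bipartite_def)

lemma simple_graph_clique_join_bipartite: "simple_graph (clique_join_bipartite n a b)"
  by (intro simple_graph_join simple_graph_complete_graph simple_graph_complete_bipartite)

lemma chromatic_number_clique_join_bipartite:
  assumes "a > 0" "b > 0"
  shows "chromatic_number (clique_join_bipartite n a b) = n + 2"
  unfolding chromatic_number_def
proof (rule Least_equality)
  let ?c = "case_sum (\<lambda>i. i) (case_sum (\<lambda>_. n) (\<lambda>_. Suc n))"
  have "proper_colouring (clique_join_bipartite n a b) ?c"
    by (auto simp: proper_colouring_clique_join_bipartite)
  moreover have "?c ` verts (clique_join_bipartite n a b) \<subseteq> {..<n + 2}"
    by (auto simp: verts_clique_join_bipartite)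
  ultimately show "colourable (clique_join_bipartite n a b) (n + 2)"
    unfolding colourable_def by blast
next
  fix m
  assume "colourable (clique_join_bipartite n a b) m"
  then obtain c where c: "proper_colouring (clique_join_bipartite n a b) c"
    "c ` verts (clique_join_bipartite n a b) \<subseteq> {..<m}"
    unfolding colourable_def by blast
  \<comment> \<open>The clique with one vertex from each side is a clique on \<open>n + 2\<close>
    vertices.\<close>
  let ?S = "insert (c (Inr (Inr 0))) (insert (c (Inr (Inl 0))) ((\<lambda>i. c (Inl i)) ` {..<n}))"
  have "card ((\<lambda>i. c (Inl i)) ` {..<n}) = n"
    using c(1) by (simp add: proper_colouring_clique_join_bipartite card_image)
  moreover have "c (Inr (Inl 0)) \<notin> (\<lambda>i. c (Inl i)) ` {..<n}"
    "c (Inr (Inr 0)) \<notin> insert (c (Inr (Inl 0))) ((\<lambda>i. c (Inl i)) ` {..<n})"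
    using c(1) assms by (auto simp: proper_colouring_clique_join_bipartite) (metis+)
  ultimately have "card ?S = n + 2"
    by simp
  moreover have "?S \<subseteq> {..<m}"
    using c(2) assms by (auto simp: verts_clique_join_bipartite)
  ultimately show "n + 2 \<le> m"
    using card_mono[of "{..<m}" ?S] by simp
qed

section \<open>Choosability for large cliques\<close>

lemma choosable_clique_join_bipartite:
  assumes "2 \<le> a" "2 * b \<le> n"
  shows "choosable (clique_join_bipartite n a b) (n + a)"
  unfolding choosable_def
proof (intro allI impI)
  fix L :: "nat + nat + nat \<Rightarrow> nat set"
  assume "\<forall>v\<in>verts (clique_join_bipartite n a b). finite (L v) \<and> n + a \<le> card (L v)"
  then have
    K: "\<And>i. i < n \<Longrightarrow> n + a \<le> card (L (Inl i))" and
    A: "\<And>i. i < a \<Longrightarrow> n + a \<le> card (L (Inr (Inl i)))" and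
    B: "\<And>i. i < b \<Longrightarrow> n + a \<le> card (L (Inr (Inr i)))"
    by (auto simp: verts_clique_join_bipartite)
  have pick: "\<exists>x. x \<in> S - T" if "finite T" "card T < card S" for S T :: "nat set"
    using that card_mono[of T S] by (metis Diff_eq_empty_iff all_not_in_conv leD)
  have pick_A: "\<exists>x. x \<in> L (Inr (Inl i)) - T" if "i < a" "finite T" "card T < n + a" for i T
    using pick[of T "L (Inr (Inl i))"] A[of i] that by simp
  have pick_B: "\<exists>x. x \<in> L (Inr (Inr j)) - T" if "j < b" "finite T" "card T < n + a" for j T
    using pick[of T "L (Inr (Inr j))"] B[of j] that by simp
  have colouring: "\<exists>c. proper_colouring (clique_join_bipartite n a b) c \<and>
      (\<forall>v\<in>verts (clique_join_bipartite n a b). c v \<in> L v)"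
    if e: "inj_on e {..<n}" "\<forall>i<n. e i \<in> L (Inl i)"
      and f: "\<forall>i<a. f i \<in> L (Inr (Inl i)) - e ` {..<n}"
      and g: "\<forall>j<b. g j \<in> L (Inr (Inr j)) - e ` {..<n} - f ` {..<a}" for e f g
  proof -
    have "proper_colouring (clique_join_bipartite n a b) (case_sum e (case_sum f g))"
      unfolding proper_colouring_clique_join_bipartite sum.case
    proof (intro conjI allI impI)
      show "e i \<noteq> f j" if "i < n" "j < a" for i j
        using f that by (metis DiffD2 image_eqI lessThan_iff)
      show "e i \<noteq> g j" if "i < n" "j < b" for i j
        using g that by (metis DiffD1 DiffD2 image_eqI lessThan_iff)
      show "f i \<noteq> g j" if "i < a" "j < b" for i j
        using g that by (metis DiffD2 image_eqI lessThan_iff)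
    qed (rule e(1))
    moreover have "\<forall>v\<in>verts (clique_join_bipartite n a b). case_sum e (case_sum f g) v \<in> L v"
      using e f g by (auto simp: verts_clique_join_bipartite)
    ultimately show ?thesis by blast
  qed
  show "\<exists>c. proper_colouring (clique_join_bipartite n a b) c \<and>
      (\<forall>v\<in>verts (clique_join_bipartite n a b). c v \<in> L v)"
  proof (cases "L (Inr (Inl 0)) \<inter> L (Inr (Inl 1)) = {}")
    case False
    then obtain x where x: "x \<in> L (Inr (Inl 0))" "x \<in> L (Inr (Inl 1))" by blast
    \<comment> \<open>Keeping \<open>x\<close> off the clique still leaves at least
      \<open>n + a - 1\<close> colours in each of its lists.\<close>
    have "card {..<n} \<le> card (L (Inl i) - {x})" if "i \<in> {..<n}" for i
      using K[of i] that assms(1) by (auto simp: card_Diff_singleton_if)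
    then obtain e where e: "inj_on e {..<n}" "\<forall>i<n. e i \<in> L (Inl i) - {x}"
      using injective_choice[of "{..<n}" "\<lambda>i. L (Inl i) - {x}"] by auto
    have card_e: "card (e ` {..<n}) = n"
      using e(1) by (simp add: card_image)
    have "\<forall>i<a. \<exists>y. y \<in> L (Inr (Inl i)) - e ` {..<n}"
      using assms(1) card_e by (intro allI impI pick_A) simp_all
    then obtain f' where f': "\<forall>i<a. f' i \<in> L (Inr (Inl i)) - e ` {..<n}"
      by metis
    define f where "f = f'(0 := x, 1 := x)"
    have f: "\<forall>i<a. f i \<in> L (Inr (Inl i)) - e ` {..<n}"
      using f' x e(2) by (auto simp: f_def)
    \<comment> \<open>The repeated \<open>x\<close> saves one colour: clique and small side together
      block at most \<open>n + a - 1\<close>.\<close>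
    have "f ` {..<a} = f ` {1..<a}"
    proof -
      have "{..<a} = insert 0 {1..<a}" using assms(1) by auto
      moreover have "f 0 \<in> f ` {1..<a}" using assms(1) by (auto simp: f_def image_iff)
      ultimately show ?thesis by (metis image_insert insert_absorb)
    qed
    then have "card (e ` {..<n} \<union> f ` {..<a}) < n + a"
      using card_Un_le[of "e ` {..<n}" "f ` {1..<a}"] card_e card_image_le[of "{1..<a}" f] assms(1)
      by simp
    then have "\<forall>j<b. \<exists>y. y \<in> L (Inr (Inr j)) - (e ` {..<n} \<union> f ` {..<a})"
      by (intro allI impI pick_B) simp_all
    then obtain g where "\<forall>j<b. g j \<in> L (Inr (Inr j)) - (e ` {..<n} \<union> f ` {..<a})"
      by metis
    then show ?thesis
      using colouring[of e f g] e f by auto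
  next
    case True
    have "card {..<n} \<le> card (L (Inl i))" if "i \<in> {..<n}" for i
      using K[of i] that by auto
    then obtain e where e: "inj_on e {..<n}" "\<forall>i<n. e i \<in> L (Inl i)"
      using injective_choice[of "{..<n}" "\<lambda>i. L (Inl i)"] by auto
    let ?E = "e ` {..<n}"
    have card_e: "card ?E = n"
      using e(1) by (simp add: card_image)
    have "\<forall>i<a. \<exists>y. y \<in> L (Inr (Inl i)) - ?E"
      using assms(1) card_e by (intro allI impI pick_A) simp_all
    then obtain f where f: "\<forall>i<a. f i \<in> L (Inr (Inl i)) - ?E"
      by metis
    \<comment> \<open>Vertices 0 and 1 have disjoint lists, so together they lose at most
      \<open>n\<close> colours to the clique. If each kept at most \<open>b\<close>, then
      \<open>2 * (n + a) \<le> 2 * b + n\<close>, against \<open>2 * b \<le> n\<close>.\<close>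
    have "\<exists>p<a. b < card (L (Inr (Inl p)) - ?E)"
    proof (rule ccontr)
      have split: "card (L (Inr (Inl i))) \<le> card (L (Inr (Inl i)) - ?E) + card (L (Inr (Inl i)) \<inter> ?E)" for i
        by (metis Un_Diff_Int card_Un_le)
      assume "\<not> ?thesis"
      then have "card (L (Inr (Inl p)) - ?E) \<le> b" if "p < a" for p
        using that by (simp add: not_less[symmetric])
      from this[of 0] this[of 1] have "card (L (Inr (Inl 0)) - ?E) \<le> b" "card (L (Inr (Inl 1)) - ?E) \<le> b"
        using assms(1) by simp_all
      moreover note split[of 0] split[of 1]
      moreover have "card (L (Inr (Inl 0)) \<inter> ?E) + card (L (Inr (Inl 1)) \<inter> ?E) \<le> n"
      proof -
        have "card (L (Inr (Inl 0)) \<inter> ?E) + card (L (Inr (Inl 1)) \<inter> ?E)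
            = card ((L (Inr (Inl 0)) \<inter> ?E) \<union> (L (Inr (Inl 1)) \<inter> ?E))"
          using True by (intro card_Un_disjoint[symmetric]) auto
        also have "\<dots> \<le> card ?E"
          by (intro card_mono) auto
        finally show ?thesis using card_e by simp
      qed
      ultimately have "2 * (n + a) \<le> 2 * b + n"
        using A[of 0] A[of 1] assms(1) by simp
      then show False using assms by simp
    qed
    then obtain p where p: "p < a" "b < card (L (Inr (Inl p)) - ?E)" by blast
    \<comment> \<open>Leaving out \<open>p\<close> caps the blocked colours at
      \<open>n + a - 1\<close>, so the large side can be coloured first; \<open>p\<close> then
      avoids its at most \<open>b\<close> colours.\<close>
    let ?R = "?E \<union> f ` ({..<a} - {p})"
    have "card ({..<a} - {p}) = a - 1" using p(1) by simp
    then have "card ?R < n + a"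
      using card_Un_le[of ?E "f ` ({..<a} - {p})"] card_e card_image_le[of "{..<a} - {p}" f] assms(1)
      by simp
    then have "\<forall>j<b. \<exists>y. y \<in> L (Inr (Inr j)) - ?R"
      by (intro allI impI pick_B) simp_all
    then obtain g where g: "\<forall>j<b. g j \<in> L (Inr (Inr j)) - ?R"
      by metis
    have "card (g ` {..<b}) < card (L (Inr (Inl p)) - ?E)"
      using p(2) card_image_le[of "{..<b}" g] by simp
    then obtain x where x: "x \<in> L (Inr (Inl p)) - ?E - g ` {..<b}"
      using pick[of "g ` {..<b}"] by blast
    have "\<forall>i<a. (f(p := x)) i \<in> L (Inr (Inl i)) - ?E"
      using f x by auto
    moreover have "\<forall>j<b. g j \<in> L (Inr (Inr j)) - ?E - (f(p := x)) ` {..<a}"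
      using g x by fastforce
    ultimately show ?thesis
      using colouring[of e "f(p := x)" g] e by blast
  qed
qed

section \<open>Lists that defeat choosability for small cliques\<close>

lemma not_choosable_clique_join_bipartite:
  assumes b: "((n + Suc m) choose Suc n) * (n + Suc m) ^ m \<le> b"
  shows "\<not> choosable (clique_join_bipartite n (Suc m) b) (n + Suc m)"
proof
  define k where "k = n + Suc m"
  \<comment> \<open>Consecutive blocks of length \<open>k\<close>: division by \<open>k\<close>
    recovers the index, which yields disjointness and injectivity of transversals.\<close>
  define A where "A i = {i * k..<Suc i * k}" for i
  have card_A: "card (A i) = k" and finite_A: "finite (A i)" for i
    by (auto simp: A_def)
  have index: "x div k = i" if "x \<in> A i" for x i
    using that unfolding A_def
    by (intro div_nat_eqI) (auto simp: mult.commute)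
  define D where "D = {P. P \<subseteq> A 0 \<and> card P = Suc n} \<times> (PiE {1..m} A)"
  define F where "F = (\<lambda>(P, f). P \<union> f ` {1..m}) ` D"
  have finite_D: "finite D"
    by (auto simp: D_def finite_A intro!: finite_PiE)
  have "card F \<le> card D"
    unfolding F_def by (rule card_image_le[OF finite_D])
  also have "card D = (k choose Suc n) * k ^ m"
    unfolding D_def by (simp add: card_cartesian_product n_subsets finite_A card_A card_PiE)
  finally have card_F: "card F \<le> b"
    using b by (simp add: k_def)
  have finite_F: "finite F"
    unfolding F_def using finite_D by simp
  have F_list: "finite S \<and> k \<le> card S" if "S \<in> F" for S
  proof -
    from that obtain P f where P: "P \<subseteq> A 0" "card P = Suc n" and f: "f \<in> PiE {1..m} A"
      and S: "S = P \<union> f ` {1..m}"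
      by (auto simp: F_def D_def)
    have f_index: "f i div k = i" if "i \<in> {1..m}" for i
      using f that by (intro index) auto
    have "inj_on f {1..m}"
      using f_index by (metis inj_onI)
    then have "card (f ` {1..m}) = m" by (simp add: card_image)
    moreover have "P \<inter> f ` {1..m} = {}"
      using f_index index[of _ 0] P(1) by fastforce
    moreover have "finite P"
      using P(1) finite_A finite_subset by blast
    ultimately show ?thesis
      using P(2) S by (simp add: card_Un_disjoint k_def)
  qed
  obtain h where h: "bij_betw h {0..<card F} F"
    using ex_bij_betw_nat_finite[OF finite_F] by blast
  \<comment> \<open>Each set in \<open>F\<close> becomes the list of one large-side vertex;
    \<open>A 0\<close> is filler for the remaining ones.\<close>
  define L :: "nat + nat + nat \<Rightarrow> nat set"
    where "L = case_sum (\<lambda>_. A 0) (case_sum A (\<lambda>j. if j < card F then h j else A 0))"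
  assume "choosable (clique_join_bipartite n (Suc m) b) (n + Suc m)"
  moreover have "\<forall>v\<in>verts (clique_join_bipartite n (Suc m) b). finite (L v) \<and> n + Suc m \<le> card (L v)"
    using F_list bij_betwE[OF h] card_A finite_A
    by (auto simp: verts_clique_join_bipartite L_def k_def)
  ultimately obtain c where c: "proper_colouring (clique_join_bipartite n (Suc m) b) c"
    "\<forall>v\<in>verts (clique_join_bipartite n (Suc m) b). c v \<in> L v"
    unfolding choosable_def by blast
  have c_list: "c v \<in> L v" if "v \<in> {..<n} <+> ({..<Suc m} <+> {..<b})" for v
    using c(2) that by (simp add: verts_clique_join_bipartite)
  have cK: "c (Inl i) \<in> A 0" if "i < n" for i
    using c_list[of "Inl i"] that by (simp add: L_def InlI)
  have cA: "c (Inr (Inl i)) \<in> A i" if "i \<le> m" for i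
    using c_list[of "Inr (Inl i)"] that by (simp add: L_def InlI InrI)
  have cB: "c (Inr (Inr j)) \<in> h j" if "j < card F" for j
    using c_list[of "Inr (Inr j)"] that card_F by (simp add: L_def InrI)
  let ?K = "(\<lambda>i. c (Inl i)) ` {..<n}"
  let ?P = "insert (c (Inr (Inl 0))) ?K"
  \<comment> \<open>Elements of \<open>PiE\<close> must be \<open>undefined\<close> off the index
    set, hence \<open>restrict\<close>.\<close>
  let ?f = "restrict (\<lambda>i. c (Inr (Inl i))) {1..m}"
  have "card ?K = n"
    using c(1) by (simp add: proper_colouring_clique_join_bipartite card_image)
  moreover have "c (Inr (Inl 0)) \<notin> ?K"
    using c(1) by (auto simp: proper_colouring_clique_join_bipartite) (metis zero_less_Suc)
  ultimately have "card ?P = Suc n" by simp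
  moreover have "?P \<subseteq> A 0"
    using cK cA[of 0] by auto
  moreover have "?f \<in> PiE {1..m} A"
    using cA by auto
  ultimately have "(\<lambda>(P, f). P \<union> f ` {1..m}) (?P, ?f) \<in> F"
    unfolding F_def by (intro imageI) (simp add: D_def)
  \<comment> \<open>The colours on the clique and the small side are exactly the list of some
    large-side vertex \<open>j\<close>, so every colour of \<open>j\<close> occurs on a
    neighbour.\<close>
  then have "?P \<union> ?f ` {1..m} \<in> h ` {0..<card F}"
    by (simp only: prod.case bij_betw_imp_surj_on[OF h])
  then obtain j where j: "j < card F" "?P \<union> ?f ` {1..m} = h j"
    by (elim imageE) simp
  have "j < b" using j(1) card_F by simp
  moreover have "c (Inr (Inr j)) \<in> ?P \<union> ?f ` {1..m}"
    using cB j by blast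
  moreover have "c (Inl i) \<noteq> c (Inr (Inr j))" if "i < n" for i
    using c(1) that \<open>j < b\<close> by (simp add: proper_colouring_clique_join_bipartite)
  moreover have "c (Inr (Inl i)) \<noteq> c (Inr (Inr j))" if "i \<le> m" for i
    using c(1) that \<open>j < b\<close> by (simp add: proper_colouring_clique_join_bipartite)
  ultimately show False by fastforce
qed

theorem theorem6:
  fixes s l b :: nat
  assumes "b > 0"
    and "b \<ge> ((l + s + 1) choose l) * (l + s + 1) ^ (s + 1)"
  shows "tau s (s + 2) b \<ge> l"
proof -
  have iff: "int (list_chromatic_number (clique_join_bipartite n (s + 2) b))
      - int (chromatic_number (clique_join_bipartite n (s + 2) b)) \<le> int s
    \<longleftrightarrow> choosable (clique_join_bipartite n (s + 2) b) (n + (s + 2))" for n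
    using assms(1) list_chromatic_number_le_iff[OF simple_graph_clique_join_bipartite, of n "s + 2" b "n + (s + 2)"]
    by (simp add: chromatic_number_clique_join_bipartite) linarith
  define n where "n = tau s (s + 2) b"
  have "choosable (clique_join_bipartite n (s + 2) b) (n + (s + 2))"
    unfolding n_def tau_def iff
    \<comment> \<open>The witness \<open>2 * b\<close> makes the set under \<open>LEAST\<close>
      nonempty, so \<open>n\<close> itself satisfies the condition.\<close>
    by (rule LeastI[of _ "2 * b"], rule choosable_clique_join_bipartite) auto
  then have large: "\<not> ((n + Suc (Suc s)) choose Suc n) * (n + Suc (Suc s)) ^ Suc s \<le> b"
    using not_choosable_clique_join_bipartite[of n "Suc s" b] by auto
  have "l \<le> n"
  proof (rule ccontr)
    assume "\<not> l \<le> n"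
    then have n: "Suc n \<le> l" by simp
    \<comment> \<open>By symmetry the lower index becomes \<open>Suc s\<close>, independent of
      \<open>n\<close>, so monotonicity in the upper index applies.\<close>
    have "(n + Suc (Suc s)) choose Suc n = (n + Suc (Suc s)) choose Suc s"
      by (subst binomial_symmetric) auto
    also have "\<dots> \<le> (l + s + 1) choose Suc s"
      using n by (intro binomial_right_mono) auto
    also have "\<dots> = (l + s + 1) choose l"
      by (subst binomial_symmetric) auto
    finally have "((n + Suc (Suc s)) choose Suc n) * (n + Suc (Suc s)) ^ Suc s
        \<le> ((l + s + 1) choose l) * (l + s + 1) ^ (s + 1)"
      using n by (intro mult_le_mono) (auto intro!: power_mono simp del: power_Suc)
    with large assms(2) show False by simp
  qed
  then show ?thesis by (simp add: n_def)
qed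

end
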